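(* Let $a_1,a_2$ be non-negative integers, $L\ge 1$ an integer, and $K=1+L+a_1+a_2$. Suppose that $K$ is a multiple of $a_1+a_2+2$. Let $R^*$ be the optimal transmission rate of the $\overline{(a_2,a_1)}_L$-ICP (which has $K$ users). Then $$R^*=a_1+a_2+2\ \text{ units}.$$
   Context: Notation: $[n]=\{1,\dots,n\}$; $\langle m\rangle_n$ is the unique element of $[n]$ congruent to $m$ modulo $n$. Index coding problem (ICP): a server holds a finite collection of files, each of size 1 unit ($F$ bits, $F$ sufficiently large), mutually unrelated (arbitrary $F$-bit strings). There are $K$ users; user $k$ wants the set of files $\mathcal W_k$ and knows the set of files $\mathcal K_k$ (side-information), with $\mathcal K_k\cap\mathcal W_k=\emptyset$. The server broadcasts one message (a function of all the files) such that every user $k$ can recover all files in $\mathcal W_k$ from the message and the files in $\mathcal K_k$. The optimal transmission rate $R^*$ is the minimum (infimum) message size, in units of the file size, over all coding strategies (and $F$ large). The $\overline{(a_2,a_1)}_L$-ICP: there are $K=1+L+a_1+a_2$ users and $2K$ files $x_{k,t}$, $k\in[K]$, $t\in\{1,2\}$. User $k\in[K]$ wants $\mathcal W_k=\{x_{k,1},x_{k,2}\}$ and knows $$\mathcal K_k=\{x_{\langle k+a_2+r\rangle_K,\,1}: r\in[L]\}\cup\{x_{\langle k+a_1+r\rangle_K,\,2}: r\in[L]\}.$$ *)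

theory Defs
  imports Complex_Main "HOL-Library.FuncSet" "HOL-Number_Theory.Cong"
begin

record ('u, 'f) icp =
  users :: "'u set"
  files :: "'f set"
  wants :: "'u \<Rightarrow> 'f set"
  knows :: "'u \<Rightarrow> 'f set"

definition wf_icp :: "('u, 'f) icp \<Rightarrow> bool" where
  "wf_icp P \<longleftrightarrow> finite (users P) \<and> finite (files P) \<and>
     (\<forall>k\<in>users P. wants P k \<subseteq> files P \<and> knows P k \<subseteq> files P \<and> knows P k \<inter> wants P k = {})"

definition bit_strings :: "nat \<Rightarrow> bool list set" where
  "bit_strings n = {bs. length bs = n}"

text \<open>The files are unrelated: every assignment of \<open>F\<close>-bit strings to the files is possible.\<close>

definition file_contents :: "('u, 'f) icp \<Rightarrow> nat \<Rightarrow> ('f \<Rightarrow> bool list) set" where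
  "file_contents P F = (\<Pi>\<^sub>E f\<in>files P. bit_strings F)"

text \<open>
  A coding strategy for files of \<open>F\<close> bits with an \<open>l\<close>-bit message: the encoder \<open>E\<close> is an
  arbitrary function of all files; the decoder \<open>D k\<close> sees only the message and the restriction
  of the file contents to the side-information of user \<open>k\<close>. Decoding is exact.
\<close>

definition index_code ::
  "('u, 'f) icp \<Rightarrow> nat \<Rightarrow> nat \<Rightarrow> (('f \<Rightarrow> bool list) \<Rightarrow> bool list) \<Rightarrow>
   ('u \<Rightarrow> bool list \<Rightarrow> ('f \<Rightarrow> bool list) \<Rightarrow> 'f \<Rightarrow> bool list) \<Rightarrow> bool" where
  "index_code P F l E D \<longleftrightarrow>
     (\<forall>x\<in>file_contents P F. E x \<in> bit_strings l \<and>
        (\<forall>k\<in>users P. \<forall>f\<in>wants P k. D k (E x) (restrict x (knows P k)) f = x f))"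

text \<open>
  One unit is \<open>F\<close> bits, so an \<open>l\<close>-bit message has size \<open>l / F\<close> units. A rate is achievable if
  it can be met for all sufficiently large file sizes.
\<close>

definition achievable_rate :: "('u, 'f) icp \<Rightarrow> real \<Rightarrow> bool" where
  "achievable_rate P R \<longleftrightarrow>
     (\<forall>\<^sub>F F in sequentially. \<exists>l E D. index_code P F l E D \<and> real l / real F \<le> R)"

definition optimal_rate :: "('u, 'f) icp \<Rightarrow> real" where
  "optimal_rate P = Inf {R. achievable_rate P R}"

lemma achievable_rate_nonneg:
  assumes "achievable_rate P R"
  shows "0 \<le> R"
proof -
  from assms obtain F l where "real l / real F \<le> R"
    unfolding achievable_rate_def eventually_sequentially by blast
  moreover have "0 \<le> real l / real F" by simp
  ultimately show ?thesis by linarith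
qed

lemma bdd_below_achievable_rate: "bdd_below {R. achievable_rate P R}"
  by (rule bdd_belowI[of _ 0]) (simp add: achievable_rate_nonneg)

definition cyc :: "nat \<Rightarrow> nat \<Rightarrow> nat" where
  "cyc n m = (THE i. i \<in> {1..n} \<and> [i = m] (mod n))"

lemma cyc_unique:
  fixes i j n :: nat
  assumes "i \<in> {1..n}" "j \<in> {1..n}" "[i = j] (mod n)"
  shows "i = j"
proof -
  have mod_eq: "m mod n = (if m = n then 0 else m)" if "m \<in> {1..n}" for m
    using that by simp
  have "(if i = n then 0 else i) = (if j = n then 0 else j)"
    using assms(3) mod_eq[OF assms(1)] mod_eq[OF assms(2)] by (simp only: cong_def)
  with assms(1,2) show ?thesis by (simp split: if_splits)
qed

lemma cyc_eqI:
  assumes "i \<in> {1..n}" "[i = m] (mod n)"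
  shows "cyc n m = i"
  unfolding cyc_def
proof (rule the_equality)
  show "j = i" if "j \<in> {1..n} \<and> [j = m] (mod n)" for j
    using that assms cyc_unique[of j n i] by (meson cong_sym cong_trans)
qed (use assms in blast)

lemma
  assumes "1 \<le> n"
  shows cyc_eq: "cyc n m = (if n dvd m then n else m mod n)"
    and cyc_in: "cyc n m \<in> {1..n}"
    and cyc_cong: "[cyc n m = m] (mod n)"
proof -
  let ?i = "if n dvd m then n else m mod n"
  have "m mod n < n" using assms by simp
  then have in_range: "?i \<in> {1..n}"
    using assms by (simp add: dvd_eq_mod_eq_0)
  have cong: "[?i = m] (mod n)"
    by (simp add: cong_def dvd_eq_mod_eq_0)
  show eq: "cyc n m = ?i" by (rule cyc_eqI[OF in_range cong])
  show "cyc n m \<in> {1..n}" using in_range by (simp only: eq)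
  show "[cyc n m = m] (mod n)" using cong by (simp only: eq)
qed

text \<open>The pair \<open>(k, t)\<close> stands for the file $x_{k,t}$.\<close>

definition cyclic_icp :: "nat \<Rightarrow> nat \<Rightarrow> nat \<Rightarrow> (nat, nat \<times> nat) icp" where
  "cyclic_icp a2 a1 L =
     (let K = 1 + L + a1 + a2 in
       \<lparr> users = {1..K},
         files = {1..K} \<times> {1, 2},
         wants = (\<lambda>k. {(k, 1), (k, 2)}),
         knows = (\<lambda>k. (\<lambda>r. (cyc K (k + a2 + r), 1)) ` {1..L} \<union>
                      (\<lambda>r. (cyc K (k + a1 + r), 2)) ` {1..L}) \<rparr>)"

lemma cyc_shift_neq:
  assumes "k \<in> {1..n}" "1 \<le> s" "s < n"
  shows "cyc n (k + s) \<noteq> k"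
proof
  assume "cyc n (k + s) = k"
  with cyc_cong[of n "k + s"] assms have "[k + 0 = k + s] (mod n)" by simp
  then have "[0 = s] (mod n)" by (simp only: cong_add_lcancel_nat)
  with assms show False by (simp add: cong_def)
qed

lemma wf_cyclic_icp: "wf_icp (cyclic_icp a2 a1 L)"
proof -
  let ?K = "1 + L + a1 + a2"
  have "cyc ?K (k + a + r) \<noteq> k" if "k \<in> {1..?K}" "r \<in> {1..L}" "a \<in> {a1, a2}" for k a r
    using cyc_shift_neq[of k ?K "a + r"] that by (auto simp: add.assoc)
  moreover have "cyc ?K m \<in> {1..?K}" for m
    by (rule cyc_in) simp
  ultimately show ?thesis
    unfolding wf_icp_def cyclic_icp_def Let_def by fastforce
qed

end

theory Submission imports Defs begin

text \<open>
  Both bounds are combinatorial. For the converse, the files \<open>x\<^sub>k\<^sub>,\<^sub>1\<close> with \<open>k \<le> a2 + 1\<close> and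
  \<open>x\<^sub>k\<^sub>,\<^sub>2\<close> with \<open>k \<le> a1 + 1\<close> form an acyclic set: a user with index \<open>k\<close> knows none of those
  with index at least \<open>k\<close>, so they can be decoded one after the other from the message once all
  other files are fixed. For achievability, put \<open>n = a1 + a2 + 2\<close>. The \<open>n - 1\<close> consecutive indices
  of the files of type \<open>t\<close> unknown to a user hit every residue class modulo \<open>n\<close> once, except
  one; since \<open>n\<close> divides \<open>K\<close>, the user knows this missed class completely and all files in
  its own class except the wanted one. Hence the \<open>n\<close> sums, modulo 2, of all files
  \<open>x\<^sub>j\<^sub>,\<^sub>1\<close> with \<open>j\<close> congruent to \<open>i\<close> and all files \<open>x\<^sub>j\<^sub>,\<^sub>2\<close> with \<open>j + a2 + 1\<close> congruent to \<open>i\<close>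
  suffice: each sum involving a wanted file contains no other unknown file.
\<close>

section \<open>Converse from acyclic sets of files\<close>

lemma finite_bit_strings: "finite (bit_strings n)"
  and card_bit_strings: "card (bit_strings n) = 2 ^ n"
  using finite_lists_length_eq[of "UNIV :: bool set" n] card_lists_length_eq[of "UNIV :: bool set" n]
  by (simp_all add: bit_strings_def)

text \<open>With the files outside \<open>A\<close> frozen, the encoder must be injective on the
  \<open>2 ^ (card A * F)\<close> contents of \<open>A\<close>: files are recovered in order of
  \<open>rank\<close>, since within \<open>A\<close> an owner knows only files of smaller
  rank.\<close>

lemma index_code_acyclic_bound:
  fixes rank :: "'f \<Rightarrow> nat"
  assumes fin: "finite (files P)" and sub: "A \<subseteq> files P"
    and owner: "\<And>f. f \<in> A \<Longrightarrow> owner f \<in> users P \<and> f \<in> wants P (owner f)"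
    and acyclic: "\<And>f g. \<lbrakk>f \<in> A; g \<in> A; g \<in> knows P (owner f)\<rbrakk> \<Longrightarrow> rank g < rank f"
    and code: "index_code P F l E D"
  shows "card A * F \<le> l"
proof -
  define B where "B f = (if f \<in> A then bit_strings F else {replicate F False})" for f
  define S where "S = (\<Pi>\<^sub>E f\<in>files P. B f)"
  have B_sub: "B f \<subseteq> bit_strings F" for f
    by (auto simp: B_def bit_strings_def)
  then have S_sub: "S \<subseteq> file_contents P F"
    unfolding S_def file_contents_def by (intro PiE_mono)
  have "inj_on E S"
  proof (rule inj_onI)
    fix x y assume x: "x \<in> S" and y: "y \<in> S" and eq: "E x = E y"
    have off: "x f = y f" if "f \<notin> A" for f
    proof (cases "f \<in> files P")
      case True
      with x y have "x f \<in> B f" "y f \<in> B f" unfolding S_def by (auto simp: PiE_mem)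
      with that show ?thesis by (simp add: B_def)
    next
      case False
      with PiE_arb[of x "files P" B f] PiE_arb[of y "files P" B f] x y show ?thesis
        unfolding S_def by simp
    qed
    have on: "x f = y f" if "f \<in> A" for f
      using that
    proof (induction "rank f" arbitrary: f rule: less_induct)
      case less
      have same: "restrict x (knows P (owner f)) = restrict y (knows P (owner f))"
      proof (rule restrict_ext)
        fix g assume "g \<in> knows P (owner f)"
        then show "x g = y g"
          using less.hyps[of g] acyclic[OF less.prems] off[of g] by blast
      qed
      have "D (owner f) (E z) (restrict z (knows P (owner f))) f = z f" if "z \<in> S" for z
        using code owner[OF less.prems] that S_sub unfolding index_code_def by blast
      from this[OF x] this[OF y] show ?case using eq same by simp
    qed
    from off on show "x = y" by blast
  qed
  moreover have "E ` S \<subseteq> bit_strings l"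
    using code S_sub unfolding index_code_def by blast
  ultimately have "card S \<le> 2 ^ l"
    using card_inj_on_le[of E S "bit_strings l"] by (simp add: finite_bit_strings card_bit_strings)
  moreover have "card S = 2 ^ (card A * F)"
  proof -
    have "card S = (\<Prod>f\<in>files P. if f \<in> A then 2 ^ F else 1)"
      unfolding S_def using fin
      by (subst card_PiE) (auto simp: B_def card_bit_strings intro!: prod.cong)
    also have "\<dots> = (\<Prod>f\<in>A. 2 ^ F)"
      using fin sub by (simp add: prod.If_cases Int_absorb1)
    also have "\<dots> = 2 ^ (card A * F)"
      by (simp add: power_mult[symmetric] mult.commute)
    finally show ?thesis .
  qed
  ultimately show ?thesis by simp
qed

lemma achievable_rate_acyclic_bound:
  fixes rank :: "'f \<Rightarrow> nat"
  assumes fin: "finite (files P)" and sub: "A \<subseteq> files P"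
    and owner: "\<And>f. f \<in> A \<Longrightarrow> owner f \<in> users P \<and> f \<in> wants P (owner f)"
    and acyclic: "\<And>f g. \<lbrakk>f \<in> A; g \<in> A; g \<in> knows P (owner f)\<rbrakk> \<Longrightarrow> rank g < rank f"
    and ach: "achievable_rate P R"
  shows "real (card A) \<le> R"
proof -
  \<comment> \<open>\<open>F \<ge> 1\<close> excludes the degenerate quotient
    \<open>real l / 0 = 0\<close>.\<close>
  obtain F l E D where "F \<ge> 1" and code: "index_code P F l E D" and R: "real l / real F \<le> R"
    using ach unfolding achievable_rate_def eventually_sequentially
    by (meson linorder_linear order_trans)
  have "card A * F \<le> l"
    using fin sub owner acyclic code by (rule index_code_acyclic_bound)
  then have "real (card A) * real F \<le> real l"
    by (simp flip: of_nat_mult)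
  with \<open>F \<ge> 1\<close> have "real (card A) \<le> real l / real F"
    by (simp add: field_simps)
  with R show ?thesis by simp
qed

section \<open>Achievability from clique covers\<close>

text \<open>Each class of \<open>c\<close> costs one unit, the XOR of its files. A user wanting a
  file of the class knows all its other files and can cancel them.\<close>

lemma achievable_rate_clique_cover:
  fixes P :: "('u, 'f) icp" and c :: "'f \<Rightarrow> nat"
  assumes fin: "finite (files P)"
    and wants: "\<And>k. k \<in> users P \<Longrightarrow> wants P k \<subseteq> files P"
    and range: "\<And>f. f \<in> files P \<Longrightarrow> c f < n"
    and clique: "\<And>k f g. \<lbrakk>k \<in> users P; f \<in> wants P k; g \<in> files P; c g = c f; g \<noteq> f\<rbrakk>
      \<Longrightarrow> g \<in> knows P k"
  shows "achievable_rate P (real n)"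
  unfolding achievable_rate_def
proof (rule eventually_sequentiallyI[of 1])
  fix F :: nat assume F: "1 \<le> F"
  \<comment> \<open>\<open>odd (card _)\<close> is the XOR of the selected bits; message bit
    \<open>i * F + p\<close> is the parity of class \<open>i\<close> at position
    \<open>p\<close>.\<close>
  define E :: "('f \<Rightarrow> bool list) \<Rightarrow> bool list" where
    "E x = map (\<lambda>m. odd (card {g \<in> files P. c g = m div F \<and> x g ! (m mod F)})) [0..<n * F]" for x
  define D :: "'u \<Rightarrow> bool list \<Rightarrow> ('f \<Rightarrow> bool list) \<Rightarrow> 'f \<Rightarrow> bool list" where
    "D k y s f = map (\<lambda>p. y ! (c f * F + p) \<noteq>
      odd (card {g \<in> files P. c g = c f \<and> g \<noteq> f \<and> s g ! p})) [0..<F]" for k y s f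
  have "index_code P F (n * F) E D"
    unfolding index_code_def
  proof (intro ballI conjI)
    fix x assume x: "x \<in> file_contents P F"
    show "E x \<in> bit_strings (n * F)" by (simp add: E_def bit_strings_def)
    fix k f assume k: "k \<in> users P" and f: "f \<in> wants P k"
    have fP: "f \<in> files P" using wants[OF k] f by blast
    show "D k (E x) (restrict x (knows P k)) f = x f"
    proof (rule nth_equalityI)
      have len: "length (x f) = F"
        using x fP unfolding file_contents_def bit_strings_def by (auto dest: PiE_mem)
      then show "length (D k (E x) (restrict x (knows P k)) f) = length (x f)"
        by (simp add: D_def)
      fix p assume "p < length (D k (E x) (restrict x (knows P k)) f)"
      then have p: "p < F" by (simp add: D_def)
      let ?rest = "{g \<in> files P. c g = c f \<and> g \<noteq> f \<and> x g ! p}"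
      have "c f * F + p < Suc (c f) * F" using p by simp
      also have "\<dots> \<le> n * F" using range[OF fP] by (intro mult_le_mono1) simp
      finally have "E x ! (c f * F + p) = odd (card {g \<in> files P. c g = c f \<and> x g ! p})"
        using p F by (simp add: E_def)
      also have "{g \<in> files P. c g = c f \<and> x g ! p} = (if x f ! p then insert f ?rest else ?rest)"
        using fP by auto
      also have "odd (card \<dots>) = (x f ! p \<noteq> odd (card ?rest))"
        using fin by auto
      \<comment> \<open>The decoder sees \<open>undefined\<close> at unknown files, but by
        \<open>clique\<close> every file counted here is known.\<close>
      also have "?rest =
          {g \<in> files P. c g = c f \<and> g \<noteq> f \<and> restrict x (knows P k) g ! p}"
        using clique[OF k f] by auto
      finally show "D k (E x) (restrict x (knows P k)) f ! p = x f ! p"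
        using p by (auto simp: D_def)
    qed
  qed
  moreover have "real (n * F) / real F \<le> real n" using F by simp
  ultimately show "\<exists>l E D. index_code P F l E D \<and> real l / real F \<le> real n" by blast
qed

section \<open>Offsets on the cycle and side-information windows\<close>

lemma mem_cyc_window:
  fixes j k K a L :: nat
  assumes "j \<in> {1..K}" "[j = k + d] (mod K)" "a < d" "d \<le> a + L"
  shows "j \<in> (\<lambda>r. cyc K (k + a + r)) ` {1..L}"
proof (rule image_eqI)
  show "j = cyc K (k + a + (d - a))"
    using assms by (intro cyc_eqI[symmetric]) (simp_all add: add.assoc)
qed (use assms in auto)

text \<open>The offset \<open>j - k\<close> is at most \<open>a\<close>, while the window has
  offsets \<open>a + 1\<close> to \<open>a + L\<close>. All are below \<open>K\<close>, so reduction
  modulo \<open>K\<close> identifies none of them.\<close>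

lemma not_mem_cyc_window:
  fixes j k K a L :: nat
  assumes "a + L < K" "k \<le> j" "j \<le> k + a"
  shows "j \<notin> (\<lambda>r. cyc K (k + a + r)) ` {1..L}"
proof
  assume "j \<in> (\<lambda>r. cyc K (k + a + r)) ` {1..L}"
  then obtain r where r: "r \<in> {1..L}" and j: "j = cyc K (k + a + r)" by blast
  obtain s where s: "j = k + s" using assms(2) le_Suc_ex by blast
  have "[k + s = k + (a + r)] (mod K)"
    using cyc_cong[of K "k + a + r"] assms(1) unfolding s[symmetric] j by (simp add: add.assoc)
  then have "[s = a + r] (mod K)" by (simp only: cong_add_lcancel_nat)
  then show False using r s assms by (simp add: cong_def)
qed

lemma ex_cyc_shift:
  fixes j k K n :: nat
  assumes "j \<in> {1..K}" "k \<in> {1..K}" "n dvd K" "[j = k + e] (mod n)"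
  obtains d where "d < K" "[j = k + d] (mod K)" "[d = e] (mod n)"
proof
  \<comment> \<open>\<open>K - k\<close> stands for \<open>- k\<close> modulo \<open>K\<close>,
    without truncation as \<open>k \<le> K\<close>.\<close>
  let ?d = "(j + (K - k)) mod K"
  show "?d < K" using assms(1) by simp
  have "[k + ?d = k + (j + (K - k))] (mod K)"
    by (simp add: cong_def mod_add_right_eq)
  also have "k + (j + (K - k)) = j + K" using assms(2) by simp
  also have "[j + K = j] (mod K)" by (simp add: cong_def)
  finally show shift: "[j = k + ?d] (mod K)" by (rule cong_sym)
  then have "[k + ?d = k + e] (mod n)"
    using assms(3,4) by (meson cong_dvd_modulus_nat cong_sym cong_trans)
  then show "[?d = e] (mod n)" by (simp only: cong_add_lcancel_nat)
qed

text \<open>The window has offsets from \<open>a + 1\<close> to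
  \<open>a + L = K - n + a + 1\<close>. Positive multiples of \<open>n\<close> below
  \<open>K\<close> lie between \<open>n\<close> and \<open>K - n\<close>; offsets congruent to
  \<open>a + 1\<close> lie between \<open>a + 1\<close> and \<open>K - n + a + 1\<close>, so both
  ends of the window can be attained.\<close>

lemma mem_cyc_window_cong:
  fixes j k K a b L n :: nat
  assumes K: "K = 1 + L + a + b" and n: "n = a + b + 2" and dvd: "n dvd K"
    and jk: "j \<in> {1..K}" "k \<in> {1..K}"
    and cong: "[j = k] (mod n) \<and> j \<noteq> k \<or> [j = k + (a + 1)] (mod n)"
  shows "j \<in> (\<lambda>r. cyc K (k + a + r)) ` {1..L}"
proof -
  obtain q where q: "K = n * q" using dvd by blast
  have step: "n * t + n \<le> K" if "n * t < K" for t
  proof -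
    from that have "Suc t \<le> q" by (simp add: q)
    then have "n * Suc t \<le> n * q" by (rule mult_le_mono2)
    then show ?thesis by (simp add: q)
  qed
  from cong show ?thesis
  proof
    assume c: "[j = k] (mod n) \<and> j \<noteq> k"
    then obtain d where d: "d < K" "[j = k + d] (mod K)" "[d = 0] (mod n)"
      using ex_cyc_shift[OF jk dvd, of 0] by auto
    from d(3) obtain t where t: "d = n * t" by (auto simp: cong_0_iff)
    have "d \<noteq> 0"
    proof
      assume "d = 0"
      with cyc_unique[OF jk] d(2) c show False by simp
    qed
    then have "n \<le> d" using t by (cases t) simp_all
    moreover have "d + n \<le> K" using step[of t] d(1) t by simp
    ultimately show ?thesis
      using K n by (intro mem_cyc_window[OF jk(1) d(2)]) simp_all
  next
    assume "[j = k + (a + 1)] (mod n)"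
    then obtain d where d: "d < K" "[j = k + d] (mod K)" "[d = a + 1] (mod n)"
      using ex_cyc_shift[OF jk dvd] by blast
    from d(3) have "d mod n = a + 1" using n by (simp add: cong_def)
    then have t: "d = n * (d div n) + (a + 1)" using mult_div_mod_eq[of n d] by simp
    moreover have "n * (d div n) + n \<le> K" using step[of "d div n"] d(1) t by linarith
    ultimately show ?thesis
      using K n by (intro mem_cyc_window[OF jk(1) d(2)]) linarith+
  qed
qed

section \<open>The two bounds for the cyclic problem\<close>

lemma cyclic_icp_simps:
  assumes "K = 1 + L + a1 + a2"
  shows "users (cyclic_icp a2 a1 L) = {1..K}"
    and "files (cyclic_icp a2 a1 L) = {1..K} \<times> {1, 2}"
    and "wants (cyclic_icp a2 a1 L) k = {(k, 1), (k, 2)}"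
    and "(j, 1) \<in> knows (cyclic_icp a2 a1 L) k \<longleftrightarrow> j \<in> (\<lambda>r. cyc K (k + a2 + r)) ` {1..L}"
    and "(j, 2) \<in> knows (cyclic_icp a2 a1 L) k \<longleftrightarrow> j \<in> (\<lambda>r. cyc K (k + a1 + r)) ` {1..L}"
  using assms by (auto simp: cyclic_icp_def Let_def)

lemma cyclic_icp_rate_lower_bound:
  assumes "achievable_rate (cyclic_icp a2 a1 L) R"
  shows "real (a1 + a2 + 2) \<le> R"
proof -
  define K where "K = 1 + L + a1 + a2"
  note P = cyclic_icp_simps[OF K_def]
  define A :: "(nat \<times> nat) set" where "A = {1..a2 + 1} \<times> {1} \<union> {1..a1 + 1} \<times> {2}"
  have "real (card A) \<le> R"
  proof (rule achievable_rate_acyclic_bound[where owner = fst and rank = fst])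
    show "finite (files (cyclic_icp a2 a1 L))" by (simp add: P)
    show "A \<subseteq> files (cyclic_icp a2 a1 L)" by (auto simp: P A_def K_def)
    show "fst f \<in> users (cyclic_icp a2 a1 L) \<and> f \<in> wants (cyclic_icp a2 a1 L) (fst f)"
      if "f \<in> A" for f using that by (auto simp: P A_def K_def)
    show "fst g < fst f"
      if f: "f \<in> A" and g: "g \<in> A" and known: "g \<in> knows (cyclic_icp a2 a1 L) (fst f)" for f g
    proof (rule ccontr)
      assume "\<not> fst g < fst f"
      then have le: "fst f \<le> fst g" by simp
      \<comment> \<open>Indices start at 1, so \<open>j \<le> a2 + 1\<close> gives
        \<open>j \<le> fst f + a2\<close>, just short of the window; likewise with
        \<open>a1\<close>.\<close>
      have pos: "1 \<le> fst f" using f by (auto simp: A_def)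
      from g consider j where "g = (j, 1)" "j \<le> a2 + 1" | j where "g = (j, 2)" "j \<le> a1 + 1"
        by (auto simp: A_def)
      then show False
      proof cases
        case 1
        then show False
          using known le pos not_mem_cyc_window[of a2 L K "fst f" j] by (simp only: P) (simp add: K_def)
      next
        case 2
        then show False
          using known le pos not_mem_cyc_window[of a1 L K "fst f" j] by (simp only: P) (simp add: K_def)
      qed
    qed
    show "achievable_rate (cyclic_icp a2 a1 L) R" by fact
  qed
  moreover have "card A = a1 + a2 + 2"
    unfolding A_def by (subst card_Un_disjoint) (auto simp: card_cartesian_product)
  ultimately show ?thesis by simp
qed

lemma cyclic_icp_rate_achievable:
  assumes K: "K = 1 + L + a1 + a2" and dvd: "(a1 + a2 + 2) dvd K"
  shows "achievable_rate (cyclic_icp a2 a1 L) (real (a1 + a2 + 2))"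
proof -
  define n where "n = a1 + a2 + 2"
  note P = cyclic_icp_simps[OF K]
  \<comment> \<open>As \<open>n = (a1 + 1) + (a2 + 1)\<close>, this shift pairs
    \<open>(k, 1)\<close> with type 2 indices congruent to \<open>k + (a1 + 1)\<close> and
    \<open>(k, 2)\<close> with type 1 indices congruent to \<open>k + (a2 + 1)\<close>: the classes
    user \<open>k\<close> knows entirely.\<close>
  define c :: "nat \<times> nat \<Rightarrow> nat" where
    "c f = (if snd f = 1 then fst f else fst f + (a2 + 1)) mod n" for f
  have window1: "(j, 1) \<in> knows (cyclic_icp a2 a1 L) k"
    if "j \<in> {1..K}" "k \<in> {1..K}" "[j = k] (mod n) \<and> j \<noteq> k \<or> [j = k + (a2 + 1)] (mod n)" for j k
    unfolding P using that dvd K by (intro mem_cyc_window_cong[of K L a2 a1 n]) (simp_all add: n_def ac_simps)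
  have window2: "(j, 2) \<in> knows (cyclic_icp a2 a1 L) k"
    if "j \<in> {1..K}" "k \<in> {1..K}" "[j = k] (mod n) \<and> j \<noteq> k \<or> [j = k + (a1 + 1)] (mod n)" for j k
    unfolding P using that dvd K by (intro mem_cyc_window_cong[of K L a1 a2 n]) (simp_all add: n_def ac_simps)
  have "achievable_rate (cyclic_icp a2 a1 L) (real n)"
  proof (rule achievable_rate_clique_cover[where c = c])
    show "finite (files (cyclic_icp a2 a1 L))" by (simp add: P)
    show "wants (cyclic_icp a2 a1 L) k \<subseteq> files (cyclic_icp a2 a1 L)"
      if "k \<in> users (cyclic_icp a2 a1 L)" for k using that by (auto simp: P)
    show "c f < n" for f by (simp add: c_def n_def)
    show "g \<in> knows (cyclic_icp a2 a1 L) k"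
      if "k \<in> users (cyclic_icp a2 a1 L)" "f \<in> wants (cyclic_icp a2 a1 L) k"
        "g \<in> files (cyclic_icp a2 a1 L)" "c g = c f" "g \<noteq> f" for k f g
    proof -
      from that(1) have k: "k \<in> {1..K}" by (simp add: P)
      from that(3) obtain j t where g: "g = (j, t)" and j: "j \<in> {1..K}" and t: "t = 1 \<or> t = 2"
        by (auto simp: P)
      from that(2) consider "f = (k, 1)" | "f = (k, 2)" by (auto simp: P)
      then show ?thesis
      proof cases
        case f: 1
        from t show ?thesis
        proof
          assume "t = 1"
          with that(4,5) f g window1[OF j k] show ?thesis by (simp add: c_def cong_def)
        next
          assume t: "t = 2"
          with that(4) f g have "[j + (a2 + 1) = k] (mod n)" by (simp add: c_def cong_def)
          \<comment> \<open>Adding \<open>a1 + 1\<close> completes the shift of \<open>j\<close> to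
            a full period \<open>n\<close>.\<close>
          then have "[j + (a2 + 1) + (a1 + 1) = k + (a1 + 1)] (mod n)"
            by (intro cong_add) simp_all
          moreover have "j + (a2 + 1) + (a1 + 1) = j + n" by (simp add: n_def)
          ultimately have "[j + n = k + (a1 + 1)] (mod n)" by (simp only:)
          then have "[j = k + (a1 + 1)] (mod n)" by (simp add: cong_def)
          with window2[OF j k] t g show ?thesis by simp
        qed
      next
        case f: 2
        from t show ?thesis
        proof
          assume "t = 1"
          with that(4) f g window1[OF j k] show ?thesis by (simp add: c_def cong_def)
        next
          assume t: "t = 2"
          with that(4) f g have "[j + (a2 + 1) = k + (a2 + 1)] (mod n)"
            by (simp add: c_def cong_def)
          then have "[j = k] (mod n)" by (simp only: cong_add_rcancel_nat)
          with that(5) f g t window2[OF j k] show ?thesis by simp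
        qed
      qed
    qed
  qed
  then show ?thesis by (simp add: n_def)
qed

theorem theorem5:
  fixes a1 a2 L K :: nat
  assumes "L \<ge> 1"
    and "K = 1 + L + a1 + a2"
    and "(a1 + a2 + 2) dvd K"
  shows "optimal_rate (cyclic_icp a2 a1 L) = real (a1 + a2 + 2)"
  unfolding optimal_rate_def
proof (rule cInf_eq_minimum)
  show "real (a1 + a2 + 2) \<in> {R. achievable_rate (cyclic_icp a2 a1 L) R}"
    using cyclic_icp_rate_achievable[OF assms(2,3)] by simp
  show "real (a1 + a2 + 2) \<le> R" if "R \<in> {R. achievable_rate (cyclic_icp a2 a1 L) R}" for R
    using cyclic_icp_rate_lower_bound that by simp
qed

end
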